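(* Let $H$ be a graph and $v$ a non-isolated vertex of $H$. Then $\mathrm{Tr}(H,v)$ is well-covered if and only if $H$ is well-covered.
   Context: All graphs are finite, simple and undirected. $\alpha(G)$ denotes the independence number of $G$, the maximum size of an independent set of vertices. A graph $G$ is well-covered if all (inclusion-)maximal independent sets of $G$ have size $\alpha(G)$. Trung's construction: for a graph $H$ and a non-isolated vertex $v$ of $H$, the graph $\mathrm{Tr}(H,v)$ is obtained from $H$ by adding three new vertices $a,b,c$ and the following edges: $c$ is joined to $b$ and to every neighbor of $v$ in $H$; $b$ is joined to $a$; and $a$ is joined to $v$. *)

theory Defs
  imports "Graph_Theory.Pair_Digraph"
begin

text \<open>
  A finite simple undirected graph is a \<^term>\<open>pair_graph\<close>: finite vertex set, and a loop-free
  symmetric set of arcs, so that every edge is represented by its two orientations.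
\<close>

definition neighbors :: "'a pair_pre_digraph \<Rightarrow> 'a \<Rightarrow> 'a set" where
  "neighbors G v = {w \<in> pverts G. (v, w) \<in> parcs G}"

definition isolated :: "'a pair_pre_digraph \<Rightarrow> 'a \<Rightarrow> bool" where
  "isolated G v \<longleftrightarrow> neighbors G v = {}"

definition independent_set :: "'a pair_pre_digraph \<Rightarrow> 'a set \<Rightarrow> bool" where
  "independent_set G S \<longleftrightarrow> S \<subseteq> pverts G \<and> (\<forall>u\<in>S. \<forall>w\<in>S. (u, w) \<notin> parcs G)"

definition maximal_independent_set :: "'a pair_pre_digraph \<Rightarrow> 'a set \<Rightarrow> bool" where
  "maximal_independent_set G S \<longleftrightarrow>
     independent_set G S \<and> (\<forall>T. independent_set G T \<and> S \<subseteq> T \<longrightarrow> T = S)"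

definition independence_number :: "'a pair_pre_digraph \<Rightarrow> nat" where
  "independence_number G = Max (card ` {S. independent_set G S})"

definition well_covered :: "'a pair_pre_digraph \<Rightarrow> bool" where
  "well_covered G \<longleftrightarrow> (\<forall>S. maximal_independent_set G S \<longrightarrow> card S = independence_number G)"

text \<open>
  The three added vertices are constructors of a new type, which makes them distinct from each
  other and from the vertices of the original graph.
\<close>

datatype 'a tr_vertex = Old 'a | New_a | New_b | New_c

definition tr_new_edges :: "'a pair_pre_digraph \<Rightarrow> 'a \<Rightarrow> ('a tr_vertex \<times> 'a tr_vertex) set" where
  "tr_new_edges H v =
     {(New_c, New_b), (New_b, New_a), (New_a, Old v)} \<union> {(New_c, Old w) | w. w \<in> neighbors H v}"

definition Tr :: "'a pair_pre_digraph \<Rightarrow> 'a \<Rightarrow> 'a tr_vertex pair_pre_digraph" where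
  "Tr H v =
     \<lparr> pverts = Old ` pverts H \<union> {New_a, New_b, New_c},
       parcs = map_prod Old Old ` parcs H \<union> tr_new_edges H v \<union> (tr_new_edges H v)\<inverse> \<rparr>"

lemma pair_graph_iff:
  "pair_graph G \<longleftrightarrow>
     finite (pverts G) \<and> parcs G \<subseteq> pverts G \<times> pverts G \<and>
     (\<forall>u w. (u, w) \<in> parcs G \<longrightarrow> (w, u) \<in> parcs G) \<and> (\<forall>u. (u, u) \<notin> parcs G)"
    (is "?L \<longleftrightarrow> ?R")
proof
  assume ?L
  then interpret pair_graph G .
  have "parcs G \<subseteq> pverts G \<times> pverts G"
  proof
    fix e assume "e \<in> parcs G"
    then show "e \<in> pverts G \<times> pverts G"
      using arc_fst_in_verts[of e] arc_snd_in_verts[of e] by (cases e) simp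
  qed
  moreover have "(w, u) \<in> parcs G" if "(u, w) \<in> parcs G" for u w
    using pair_sym_arcs that by (simp add: symmetric_def symD)
  moreover have "(u, u) \<notin> parcs G" for u
    using no_loops'[of u u] by blast
  ultimately show ?R
    using pair_finite_verts by blast
next
  assume R: ?R
  have ends: "parcs G \<subseteq> pverts G \<times> pverts G" and fin: "finite (pverts G)"
    using R by simp_all
  show ?L
  proof (unfold_locales)
    show "finite (parcs G)"
      by (rule finite_subset[OF ends]) (simp add: fin)
    show "finite (pverts G)" by (rule fin)
    show "symmetric (with_proj G)"
      unfolding symmetric_def using R by (simp add: sym_def arcs_ends_def arc_to_ends_def)
  next
    fix e assume "e \<in> parcs G"
    then show "fst e \<in> pverts G" "snd e \<in> pverts G" using ends by (metis mem_Times_iff subsetD)+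
    show "fst e \<noteq> snd e" using R \<open>e \<in> parcs G\<close> by (cases e) auto
  qed
qed

lemma pair_graph_Tr:
  assumes "pair_graph H" and "v \<in> pverts H"
  shows "pair_graph (Tr H v)"
proof -
  have H: "finite (pverts H)" "\<And>p q. (p, q) \<in> parcs H \<Longrightarrow> p \<in> pverts H \<and> q \<in> pverts H"
    "\<And>p q. (p, q) \<in> parcs H \<Longrightarrow> (q, p) \<in> parcs H" "\<And>p. (p, p) \<notin> parcs H"
    using assms(1) unfolding pair_graph_iff by blast+
  have old: "(x, y) \<in> map_prod Old Old ` parcs H \<longleftrightarrow>
      (\<exists>p q. x = Old p \<and> y = Old q \<and> (p, q) \<in> parcs H)" for x y
    by auto
  have V: "pverts (Tr H v) = Old ` pverts H \<union> {New_a, New_b, New_c}"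
    by (simp add: Tr_def)
  have E: "(x, y) \<in> parcs (Tr H v) \<longleftrightarrow> (\<exists>p q. x = Old p \<and> y = Old q \<and> (p, q) \<in> parcs H) \<or>
      (x, y) \<in> tr_new_edges H v \<or> (y, x) \<in> tr_new_edges H v" for x y
    by (simp add: Tr_def old)
  have N: "x \<in> pverts (Tr H v) \<and> y \<in> pverts (Tr H v) \<and> x \<noteq> y" if "(x, y) \<in> tr_new_edges H v" for x y
    using that assms(2) unfolding V tr_new_edges_def neighbors_def by blast
  have "finite (pverts (Tr H v))"
    unfolding V using H(1) by simp
  moreover have "parcs (Tr H v) \<subseteq> pverts (Tr H v) \<times> pverts (Tr H v)"
  proof (rule subrelI)
    fix x y assume "(x, y) \<in> parcs (Tr H v)"
    then consider p q where "x = Old p" "y = Old q" "(p, q) \<in> parcs H"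
      | "(x, y) \<in> tr_new_edges H v" | "(y, x) \<in> tr_new_edges H v"
      unfolding E by blast
    then show "(x, y) \<in> pverts (Tr H v) \<times> pverts (Tr H v)"
    proof cases
      case 1
      then show ?thesis using H(2) unfolding V by blast
    qed (use N in blast)+
  qed
  moreover have "(y, x) \<in> parcs (Tr H v)" if "(x, y) \<in> parcs (Tr H v)" for x y
    using that H(3) unfolding E by blast
  moreover have "(x, x) \<notin> parcs (Tr H v)" for x
    using H(4) N unfolding E by blast
  ultimately show ?thesis
    unfolding pair_graph_iff by blast
qed

end

theory Submission
  imports Defs
begin

text \<open>
  In \<^term>\<open>Tr H v\<close> the new vertices form a path \<^term>\<open>New_a\<close>, \<^term>\<open>New_b\<close>, \<^term>\<open>New_c\<close>, where
  choosing \<^term>\<open>New_a\<close> excludes \<^term>\<open>v\<close>, and choosing \<^term>\<open>New_c\<close> excludes the neighbors of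
  \<^term>\<open>v\<close>. The point is that passing from \<^term>\<open>H\<close> to \<^term>\<open>Tr H v\<close> shifts the set of sizes of
  maximal independent sets by exactly one.

  Adding \<^term>\<open>New_b\<close> to a maximal independent set of \<^term>\<open>H\<close> always gives a maximal independent
  set of \<^term>\<open>Tr H v\<close>, because \<^term>\<open>New_b\<close> dominates the other two new vertices. Conversely, a
  maximal independent set of \<^term>\<open>Tr H v\<close> meets the path either in one vertex, and then its old part
  is already maximal in \<^term>\<open>H\<close>, or in both ends, and then it avoids \<^term>\<open>v\<close> and all neighbors of
  \<^term>\<open>v\<close>, so that trading the two ends for \<^term>\<open>v\<close> gives a maximal independent set of \<^term>\<open>H\<close>.

  Since a largest independent set is maximal, being well-covered means that all maximal independent
  sets have the same size, and this property is invariant under the shift.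
\<close>

text \<open>
  If a larger independent set exists, then a single vertex can already be added, so maximality can
  be tested one vertex at a time.
\<close>

lemma maximal_independent_set_iff_dominating:
  assumes "pair_graph G"
  shows "maximal_independent_set G S \<longleftrightarrow>
     independent_set G S \<and> (\<forall>u\<in>pverts G - S. \<exists>w\<in>S. (u, w) \<in> parcs G)"
    (is "?L \<longleftrightarrow> ?R")
proof
  have sym: "\<And>u w. (u, w) \<in> parcs G \<Longrightarrow> (w, u) \<in> parcs G"
    and loopfree: "\<And>u. (u, u) \<notin> parcs G"
    using assms unfolding pair_graph_iff by blast+
  assume L: ?L
  then have ind: "independent_set G S"
    by (simp add: maximal_independent_set_def)
  have "\<exists>w\<in>S. (u, w) \<in> parcs G" if u: "u \<in> pverts G - S" for u
  proof (rule ccontr)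
    assume "\<not> ?thesis"
    then have "independent_set G (insert u S)"
      using ind u sym loopfree unfolding independent_set_def by blast
    then have "insert u S = S"
      using L unfolding maximal_independent_set_def by blast
    then show False
      using u by blast
  qed
  then show ?R
    using ind by blast
next
  assume R: ?R
  then show ?L
    unfolding maximal_independent_set_def independent_set_def by blast
qed

lemma independent_set_card_le_independence_number:
  assumes "finite (pverts G)" and "independent_set G S"
  shows "card S \<le> independence_number G"
proof -
  have "finite {S. independent_set G S}"
    by (rule finite_subset[of _ "Pow (pverts G)"]) (auto simp: independent_set_def assms(1))
  then show ?thesis
    unfolding independence_number_def using assms(2) by (intro Max_ge) auto
qed

lemma maximal_independent_set_of_max_card:
  assumes "finite (pverts G)"
  obtains S where "maximal_independent_set G S" and "card S = independence_number G"
proof -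
  let ?I = "{S. independent_set G S}"
  have "finite ?I"
    by (rule finite_subset[of _ "Pow (pverts G)"]) (auto simp: independent_set_def assms)
  moreover have "{} \<in> ?I"
    by (simp add: independent_set_def)
  ultimately have "independence_number G \<in> card ` ?I"
    unfolding independence_number_def by (intro Max_in) auto
  then obtain S where S: "independent_set G S" "card S = independence_number G"
    by auto
  have "T = S" if T: "independent_set G T" "S \<subseteq> T" for T
  proof -
    have "finite T"
      using T(1) assms unfolding independent_set_def by (blast intro: finite_subset)
    moreover have "card T \<le> card S"
      using independent_set_card_le_independence_number[OF assms T(1)] S(2) by simp
    ultimately show ?thesis
      using T(2) card_seteq by metis
  qed
  then have "maximal_independent_set G S"
    using S(1) unfolding maximal_independent_set_def by blast
  then show thesis
    using that S(2) by blast
qed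

text \<open>
  This form no longer mentions the independence number, so that two graphs can be compared through
  the sizes of their maximal independent sets alone.
\<close>

lemma well_covered_iff_equal_cards:
  assumes "finite (pverts G)"
  shows "well_covered G \<longleftrightarrow>
    (\<forall>S T. maximal_independent_set G S \<longrightarrow> maximal_independent_set G T \<longrightarrow> card S = card T)"
proof -
  obtain M where "maximal_independent_set G M" "card M = independence_number G"
    using maximal_independent_set_of_max_card[OF assms] .
  then show ?thesis
    unfolding well_covered_def by metis
qed

lemma pverts_Tr_simps [simp]:
  "Old u \<in> pverts (Tr H v) \<longleftrightarrow> u \<in> pverts H"
  "New_a \<in> pverts (Tr H v)" "New_b \<in> pverts (Tr H v)" "New_c \<in> pverts (Tr H v)"
  by (auto simp: Tr_def)

lemma parcs_Tr_simps [simp]: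
  "(Old p, Old q) \<in> parcs (Tr H v) \<longleftrightarrow> (p, q) \<in> parcs H"
  "(Old p, New_a) \<in> parcs (Tr H v) \<longleftrightarrow> p = v"
  "(Old p, New_b) \<in> parcs (Tr H v) \<longleftrightarrow> False"
  "(Old p, New_c) \<in> parcs (Tr H v) \<longleftrightarrow> p \<in> neighbors H v"
  "(New_a, Old p) \<in> parcs (Tr H v) \<longleftrightarrow> p = v"
  "(New_a, New_a) \<in> parcs (Tr H v) \<longleftrightarrow> False"
  "(New_a, New_b) \<in> parcs (Tr H v) \<longleftrightarrow> True"
  "(New_a, New_c) \<in> parcs (Tr H v) \<longleftrightarrow> False"
  "(New_b, Old p) \<in> parcs (Tr H v) \<longleftrightarrow> False"
  "(New_b, New_a) \<in> parcs (Tr H v) \<longleftrightarrow> True"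
  "(New_b, New_b) \<in> parcs (Tr H v) \<longleftrightarrow> False"
  "(New_b, New_c) \<in> parcs (Tr H v) \<longleftrightarrow> True"
  "(New_c, Old p) \<in> parcs (Tr H v) \<longleftrightarrow> p \<in> neighbors H v"
  "(New_c, New_a) \<in> parcs (Tr H v) \<longleftrightarrow> False"
  "(New_c, New_b) \<in> parcs (Tr H v) \<longleftrightarrow> True"
  "(New_c, New_c) \<in> parcs (Tr H v) \<longleftrightarrow> False"
  by (auto simp: Tr_def tr_new_edges_def)

lemma card_tr_vertex_set:
  assumes "finite S"
  shows "card S = card (Old -` S) + card (S \<inter> {New_a, New_b, New_c})"
proof -
  have "S = Old ` (Old -` S) \<union> S \<inter> {New_a, New_b, New_c}"
  proof (rule set_eqI)
    fix x show "x \<in> S \<longleftrightarrow> x \<in> Old ` (Old -` S) \<union> S \<inter> {New_a, New_b, New_c}"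
      by (cases x) auto
  qed
  moreover have "card (Old ` (Old -` S) \<union> S \<inter> {New_a, New_b, New_c}) =
      card (Old ` (Old -` S)) + card (S \<inter> {New_a, New_b, New_c})"
    by (rule card_Un_disjoint) (auto simp: assms finite_vimageI inj_def)
  moreover have "card (Old ` (Old -` S)) = card (Old -` S)"
    by (rule card_image) (simp add: inj_on_def)
  ultimately show ?thesis
    by simp
qed

text \<open>
  \<^term>\<open>New_b\<close> has no old neighbor, so it never conflicts with \<^term>\<open>M\<close>, and it is adjacent to both
  other new vertices, so these cannot be added.
\<close>

lemma maximal_independent_set_Tr_insert_b:
  assumes H: "pair_graph H" and v: "v \<in> pverts H" and M: "maximal_independent_set H M"
  shows "maximal_independent_set (Tr H v) (insert New_b (Old ` M))"
proof -
  have M: "M \<subseteq> pverts H" "\<And>u w. u \<in> M \<Longrightarrow> w \<in> M \<Longrightarrow> (u, w) \<notin> parcs H"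
    "\<And>u. u \<in> pverts H \<Longrightarrow> u \<notin> M \<Longrightarrow> \<exists>w\<in>M. (u, w) \<in> parcs H"
    using M unfolding maximal_independent_set_iff_dominating[OF H] independent_set_def by blast+
  have "independent_set (Tr H v) (insert New_b (Old ` M))"
    using M(1,2) by (auto simp: independent_set_def)
  moreover have "\<exists>y\<in>insert New_b (Old ` M). (x, y) \<in> parcs (Tr H v)"
    if "x \<in> pverts (Tr H v) - insert New_b (Old ` M)" for x
    using that M(3) by (cases x) auto
  ultimately show ?thesis
    unfolding maximal_independent_set_iff_dominating[OF pair_graph_Tr[OF H v]] by blast
qed

text \<open>
  If both ends of the path are chosen, they keep out \<^term>\<open>v\<close> and its neighbors, so \<^term>\<open>v\<close> is
  free to replace them. If at most one end is chosen, then every old vertex that this end dominates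
  is also dominated by an old one, because the other end of the path must be dominated as well.
\<close>

lemma maximal_independent_set_of_Tr:
  assumes H: "pair_graph H" and v: "v \<in> pverts H" and S: "maximal_independent_set (Tr H v) S"
  obtains M where "maximal_independent_set H M" and "card S = Suc (card M)"
proof -
  have sym: "\<And>u w. (u, w) \<in> parcs H \<Longrightarrow> (w, u) \<in> parcs H"
    and loopfree: "\<And>u. (u, u) \<notin> parcs H"
    using H unfolding pair_graph_iff by blast+
  have nbr: "w \<in> neighbors H v \<longleftrightarrow> (v, w) \<in> parcs H" for w
    using H unfolding pair_graph_iff neighbors_def by blast
  have sub: "S \<subseteq> pverts (Tr H v)"
    and ind: "\<And>x y. x \<in> S \<Longrightarrow> y \<in> S \<Longrightarrow> (x, y) \<notin> parcs (Tr H v)"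
    and dom: "\<And>x. x \<in> pverts (Tr H v) \<Longrightarrow> x \<notin> S \<Longrightarrow> \<exists>y\<in>S. (x, y) \<in> parcs (Tr H v)"
    using S unfolding maximal_independent_set_iff_dominating[OF pair_graph_Tr[OF H v]]
      independent_set_def by blast+
  have "finite (pverts (Tr H v))"
    using pair_graph_Tr[OF H v] unfolding pair_graph_iff by blast
  then have finS: "finite S"
    using sub by (rule rev_finite_subset)
  define A where "A = Old -` S"
  have memA: "u \<in> A \<longleftrightarrow> Old u \<in> S" for u
    by (simp add: A_def)
  have finA: "finite A"
    unfolding A_def using finS by (simp add: finite_vimageI inj_def)
  have A_sub: "A \<subseteq> pverts H"
    using sub by (auto simp: memA)
  have A_ind: "(u, w) \<notin> parcs H" if "u \<in> A" "w \<in> A" for u w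
    using ind[of "Old u" "Old w"] that by (simp add: memA)
  have A_dom: "(\<exists>w\<in>A. (u, w) \<in> parcs H) \<or> u = v \<and> New_a \<in> S \<or> u \<in> neighbors H v \<and> New_c \<in> S"
    if u: "u \<in> pverts H" "u \<notin> A" for u
  proof -
    obtain y where "y \<in> S" "(Old u, y) \<in> parcs (Tr H v)"
      using dom[of "Old u"] u by (auto simp: memA)
    then show ?thesis
      by (cases y) (auto simp: memA)
  qed
  have dom_a: "New_a \<in> S \<or> New_b \<in> S \<or> v \<in> A"
  proof (rule ccontr)
    assume none: "\<not> ?thesis"
    then obtain y where "y \<in> S" "(New_a, y) \<in> parcs (Tr H v)"
      using dom[of New_a] by auto
    then show False
      using none by (cases y) (auto simp: memA)
  qed
  have dom_b: "New_a \<in> S \<or> New_b \<in> S \<or> New_c \<in> S"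
  proof (rule ccontr)
    assume none: "\<not> ?thesis"
    then obtain y where "y \<in> S" "(New_b, y) \<in> parcs (Tr H v)"
      using dom[of New_b] by auto
    then show False
      using none by (cases y) auto
  qed
  have dom_c: "New_c \<in> S \<or> New_b \<in> S \<or> (\<exists>w\<in>A. (v, w) \<in> parcs H)"
  proof (rule ccontr)
    assume none: "\<not> ?thesis"
    then obtain y where "y \<in> S" "(New_c, y) \<in> parcs (Tr H v)"
      using dom[of New_c] by auto
    then show False
      using none by (cases y) (auto simp: memA nbr)
  qed
  have b: "New_b \<notin> S" if "New_a \<in> S \<or> New_c \<in> S"
    using that ind[of New_b New_a] ind[of New_b New_c] by auto
  show thesis
  proof (cases "New_a \<in> S \<and> New_c \<in> S")
    case True
    have vA: "v \<notin> A"
      using True ind[of New_a "Old v"] by (auto simp: memA)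
    have NA: "(v, w) \<notin> parcs H" if "w \<in> A" for w
      using True ind[of New_c "Old w"] that by (auto simp: memA nbr)
    have "independent_set H (insert v A)"
      using A_sub v A_ind NA sym loopfree unfolding independent_set_def by blast
    moreover have "\<exists>w\<in>insert v A. (u, w) \<in> parcs H" if "u \<in> pverts H - insert v A" for u
      using A_dom[of u] that sym by (auto simp: nbr)
    ultimately have "maximal_independent_set H (insert v A)"
      unfolding maximal_independent_set_iff_dominating[OF H] by blast
    moreover have "S \<inter> {New_a, New_b, New_c} = {New_a, New_c}"
      using True b by auto
    then have "card S = Suc (card (insert v A))"
      using card_tr_vertex_set[OF finS] finA vA by (simp add: A_def)
    ultimately show thesis
      by (rule that)
  next
    case False
    \<comment> \<open>If \<^term>\<open>v\<close> is dominated only through \<^term>\<open>New_a\<close>, then \<^term>\<open>New_c\<close> can be dominated only by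
      an old neighbor of \<^term>\<open>v\<close>; if a neighbor of \<^term>\<open>v\<close> is dominated only through
      \<^term>\<open>New_c\<close>, then \<^term>\<open>New_a\<close> can be dominated only by \<^term>\<open>v\<close>. Either way the old part
      takes over.\<close>
    have "\<exists>w\<in>A. (u, w) \<in> parcs H" if u: "u \<in> pverts H - A" for u
    proof -
      consider "\<exists>w\<in>A. (u, w) \<in> parcs H" | "u = v" "New_a \<in> S"
        | "u \<in> neighbors H v" "New_c \<in> S"
        using A_dom[of u] u by blast
      then show ?thesis
      proof cases
        case 2
        then show ?thesis
          using dom_c b False by blast
      next
        case 3
        then have "v \<in> A" "(u, v) \<in> parcs H"
          using dom_a b False sym by (auto simp: nbr)
        then show ?thesis
          by blast
      qed
    qed
    moreover have "independent_set H A"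
      using A_sub A_ind unfolding independent_set_def by blast
    ultimately have "maximal_independent_set H A"
      unfolding maximal_independent_set_iff_dominating[OF H] by blast
    moreover have "\<exists>x. S \<inter> {New_a, New_b, New_c} = {x}"
      using dom_b b False by auto
    then have "card (S \<inter> {New_a, New_b, New_c}) = 1"
      unfolding card_1_singleton_iff One_nat_def .
    then have "card S = Suc (card A)"
      using card_tr_vertex_set[OF finS] by (simp add: A_def)
    ultimately show thesis
      by (rule that)
  qed
qed

theorem theorem3p3:
  fixes H :: "'a pair_pre_digraph" and v :: 'a
  assumes "pair_graph H" and "v \<in> pverts H" and "\<not> isolated H v"
  shows "well_covered (Tr H v) \<longleftrightarrow> well_covered H"
proof -
  note H = assms(1) and v = assms(2)
  have finH: "finite (pverts H)" and finTr: "finite (pverts (Tr H v))"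
    using H pair_graph_Tr[OF H v] unfolding pair_graph_iff by blast+
  have card_insert_b: "card (insert New_b (Old ` M)) = Suc (card M)"
    if "maximal_independent_set H M" for M
  proof -
    have "finite M"
      using that finH unfolding maximal_independent_set_def independent_set_def
      by (blast intro: finite_subset)
    moreover have "card (Old ` M) = card M"
      by (rule card_image) (simp add: inj_on_def)
    ultimately show ?thesis
      by (simp add: image_iff)
  qed
  show ?thesis
    unfolding well_covered_iff_equal_cards[OF finH] well_covered_iff_equal_cards[OF finTr]
  proof (intro iffI allI impI)
    fix M N
    assume "\<forall>S T. maximal_independent_set (Tr H v) S \<longrightarrow> maximal_independent_set (Tr H v) T
        \<longrightarrow> card S = card T"
      and M: "maximal_independent_set H M" and N: "maximal_independent_set H N"
    then have "card (insert New_b (Old ` M)) = card (insert New_b (Old ` N))"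
      using maximal_independent_set_Tr_insert_b[OF H v] by blast
    then show "card M = card N"
      using card_insert_b[OF M] card_insert_b[OF N] by simp
  next
    fix S T
    assume eq: "\<forall>M N. maximal_independent_set H M \<longrightarrow> maximal_independent_set H N
        \<longrightarrow> card M = card N"
      and S: "maximal_independent_set (Tr H v) S" and T: "maximal_independent_set (Tr H v) T"
    obtain M where "maximal_independent_set H M" "card S = Suc (card M)"
      using maximal_independent_set_of_Tr[OF H v S] .
    moreover obtain N where "maximal_independent_set H N" "card T = Suc (card N)"
      using maximal_independent_set_of_Tr[OF H v T] .
    ultimately show "card S = card T"
      using eq by metis
  qed
qed

end
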